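(* Suppose that strong duality and dual strict complementarity hold for the primal SDP (P) and the dual SDP (D). Let $(\bar X^\star,\bar y^\star,\bar Z^\star)$ be a triple of primal and dual optimal solutions satisfying dual strict complementarity. Let $f_{\mathrm P}(X)=\langle C,X\rangle+g(X)$, where $g:\mathbb S^n\to\mathbb R\cup\{+\infty\}$ is either the indicator function $g=\delta_{\mathbb S^n_+}$ or the exact penalty function $g(X)=\rho\max\{0,\lambda_{\max}(-X)\}$ with $\rho>\mathrm{tr}(\bar Z^\star)$. Then for any compact set $\mathcal U\subseteq\mathbb S^n$ containing an optimal solution $X^\star\in\Omega_{\mathrm P}$, there exist constants $\kappa,\gamma,\alpha>0$ such that $$f_{\mathrm P}(X)-p^\star+\gamma\|\mathcal A(X)-b\|\ \ge\ \kappa\cdot\mathrm{dist}^2(X,\Omega_{\mathrm P}),\qquad\forall X\in\mathcal U,$$ $$\langle C,X\rangle-p^\star+\gamma\|\mathcal A(X)-b\|+\alpha\cdot\mathrm{dist}(X,\mathbb S^n_+)\ \ge\ \kappa\cdot\mathrm{dist}^2(X,\Omega_{\mathrm P}),\qquad\forall X\in\mathcal U.$$ If, in addition, $\Omega_{\mathrm P}$ is compact, then the set $\mathcal U$ in both inequalities can be chosen as any sublevel set $\{X\in\mathbb S^n\mid f_{\mathrm P}(X)\le\beta,\ \mathcal A(X)=b\}$ with $\beta$ finite.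
   Context: $\mathbb S^n$ is the space of real symmetric $n\times n$ matrices with inner product $\langle X,Y\rangle=\mathrm{tr}(XY)$ and Frobenius norm $\|\cdot\|$; $\mathbb S^n_+$ is the cone of positive semidefinite matrices; $\mathbb R^m$ carries the Euclidean norm; $\mathrm{dist}$ is the distance with respect to these norms. $\delta_S$ is the indicator function of $S$ ($0$ on $S$, $+\infty$ elsewhere). Data: $C\in\mathbb S^n$, $b\in\mathbb R^m$, $A_1,\dots,A_m\in\mathbb S^n$, $\mathcal A:\mathbb S^n\to\mathbb R^m$, $\mathcal A(X)=(\langle A_1,X\rangle,\dots,\langle A_m,X\rangle)^{\mathsf T}$, with adjoint $\mathcal A^*(y)=\sum_i y_iA_i$. Standing assumption: $\mathcal A$ is surjective (equivalently, $A_1,\dots,A_m$ are linearly independent). (P): $p^\star=\min_{X\in\mathbb S^n}\langle C,X\rangle$ subject to $\mathcal A(X)=b$, $X\in\mathbb S^n_+$. (D): $d^\star=\max_{y\in\mathbb R^m,Z\in\mathbb S^n}\langle b,y\rangle$ subject to $\mathcal A^*(y)+Z=C$, $Z\in\mathbb S^n_+$. $\Omega_{\mathrm P}=\{X\in\mathbb S^n_+\mid\langle C,X\rangle=p^\star,\mathcal A(X)=b\}$ and $\Omega_{\mathrm D}=\{(y,Z)\in\mathbb R^m\times\mathbb S^n_+\mid\langle b,y\rangle=d^\star,\mathcal A^*(y)+Z=C\}$ are the optimal solution sets. Strong duality means $p^\star=d^\star$. A triple with $X^\star\in\Omega_{\mathrm P}$, $(y^\star,Z^\star)\in\Omega_{\mathrm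 D}$ satisfies dual strict complementarity if $X^\star\in\mathrm{relint}\big(\mathcal N_{(\mathbb S^n_+)^\circ}(-Z^\star)\big)$, where $(\mathbb S^n_+)^\circ=-\mathbb S^n_+$ is the polar cone, $\mathcal N$ denotes the normal cone and $\mathrm{relint}$ the relative interior. (P) and (D) satisfy dual strict complementarity if at least one such triple exists. *)

theory Defs
  imports "HOL-Analysis.Analysis"
begin

section \<open>Symmetric matrices\<close>

text \<open>
  The space of symmetric matrices is a linear subspace of the type of all square matrices, and
  every notion below that depends on the ambient space is taken relative to that subspace.
\<close>

definition sym_mats :: "(real^'n^'n) set" where
  "sym_mats = {X. transpose X = X}"

definition trace_inner :: "real^'n^'n \<Rightarrow> real^'n^'n \<Rightarrow> real" where
  "trace_inner X Y = trace (X ** Y)"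

definition psd_cone :: "(real^'n^'n) set" where
  "psd_cone = {X \<in> sym_mats. \<forall>v. 0 \<le> v \<bullet> (X *v v)}"

definition lambda_max :: "real^'n^'n \<Rightarrow> real" where
  "lambda_max X = Max {l. \<exists>v. v \<noteq> 0 \<and> X *v v = l *\<^sub>R v}"

text \<open>
  On symmetric matrices the trace inner product is the inner product of the type, so the norm,
  distance and topology of the type are those of the Frobenius norm.
\<close>

lemma trace_inner_eq_inner:
  assumes "X \<in> sym_mats"
  shows "trace_inner X Y = X \<bullet> Y"
proof -
  have "X $ i $ k = X $ k $ i" for i k
    using assms by (metis (mono_tags, lifting) mem_Collect_eq sym_mats_def transpose_def vec_lambda_beta)
  then have "trace_inner X Y = (\<Sum>i\<in>UNIV. \<Sum>k\<in>UNIV. X $ k $ i * Y $ k $ i)"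
    by (simp add: trace_inner_def trace_def matrix_matrix_mult_def)
  also have "\<dots> = X \<bullet> Y"
    by (subst sum.swap) (simp add: inner_vec_def)
  finally show ?thesis .
qed

lemma norm_eq_sqrt_trace_inner:
  assumes "X \<in> sym_mats"
  shows "norm X = sqrt (trace_inner X X)"
  using trace_inner_eq_inner[OF assms] by (simp add: norm_eq_sqrt_inner)


section \<open>Polar and normal cones in the space of symmetric matrices\<close>

definition polar_cone :: "(real^'n^'n) set \<Rightarrow> (real^'n^'n) set" where
  "polar_cone K = {Y \<in> sym_mats. \<forall>X\<in>K. trace_inner Y X \<le> 0}"

definition normal_cone :: "(real^'n^'n) set \<Rightarrow> real^'n^'n \<Rightarrow> (real^'n^'n) set" where
  "normal_cone K X = {Y \<in> sym_mats. X \<in> K \<and> (\<forall>W\<in>K. trace_inner Y (W - X) \<le> 0)}"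


section \<open>The primal and dual semidefinite programs\<close>

definition constr_map :: "('m \<Rightarrow> real^'n^'n) \<Rightarrow> real^'n^'n \<Rightarrow> real^'m" where
  "constr_map A X = (\<chi> i. trace_inner (A i) X)"

definition constr_adj :: "('m::finite \<Rightarrow> real^'n^'n) \<Rightarrow> real^'m \<Rightarrow> real^'n^'n" where
  "constr_adj A y = (\<Sum>i\<in>UNIV. (y $ i) *\<^sub>R A i)"

definition primal_feasible :: "('m \<Rightarrow> real^'n^'n) \<Rightarrow> real^'m \<Rightarrow> (real^'n^'n) set" where
  "primal_feasible A b = {X \<in> psd_cone. constr_map A X = b}"

definition dual_feasible ::
    "real^'n^'n \<Rightarrow> ('m::finite \<Rightarrow> real^'n^'n) \<Rightarrow> ((real^'m) \<times> (real^'n^'n)) set" where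
  "dual_feasible C A = {(y, Z). Z \<in> psd_cone \<and> constr_adj A y + Z = C}"

text \<open>
  Optimal values are extended reals, so that an infeasible or unbounded program does not receive
  an arbitrary real value; they are finite as soon as the solution sets are nonempty.
\<close>

definition primal_value :: "real^'n^'n \<Rightarrow> ('m \<Rightarrow> real^'n^'n) \<Rightarrow> real^'m \<Rightarrow> ereal" where
  "primal_value C A b = (INF X\<in>primal_feasible A b. ereal (trace_inner C X))"

definition dual_value :: "real^'n^'n \<Rightarrow> ('m::finite \<Rightarrow> real^'n^'n) \<Rightarrow> real^'m \<Rightarrow> ereal" where
  "dual_value C A b = (SUP (y, Z)\<in>dual_feasible C A. ereal (b \<bullet> y))"

definition primal_solutions ::
    "real^'n^'n \<Rightarrow> ('m \<Rightarrow> real^'n^'n) \<Rightarrow> real^'m \<Rightarrow> (real^'n^'n) set" where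
  "primal_solutions C A b =
     {X \<in> psd_cone. ereal (trace_inner C X) = primal_value C A b \<and> constr_map A X = b}"

definition dual_solutions ::
    "real^'n^'n \<Rightarrow> ('m::finite \<Rightarrow> real^'n^'n) \<Rightarrow> real^'m \<Rightarrow> ((real^'m) \<times> (real^'n^'n)) set" where
  "dual_solutions C A b =
     {(y, Z). Z \<in> psd_cone \<and> ereal (b \<bullet> y) = dual_value C A b \<and> constr_adj A y + Z = C}"

definition strong_duality :: "real^'n^'n \<Rightarrow> ('m::finite \<Rightarrow> real^'n^'n) \<Rightarrow> real^'m \<Rightarrow> bool" where
  "strong_duality C A b \<longleftrightarrow> primal_value C A b = dual_value C A b"

definition dual_strict_complementary ::
    "real^'n^'n \<Rightarrow> ('m::finite \<Rightarrow> real^'n^'n) \<Rightarrow> real^'m \<Rightarrow>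
     real^'n^'n \<Rightarrow> real^'m \<Rightarrow> real^'n^'n \<Rightarrow> bool" where
  "dual_strict_complementary C A b X y Z \<longleftrightarrow>
     X \<in> primal_solutions C A b \<and> (y, Z) \<in> dual_solutions C A b \<and>
     X \<in> rel_interior (normal_cone (polar_cone psd_cone) (- Z))"


section \<open>Penalised objective\<close>

definition set_indicator :: "'a set \<Rightarrow> 'a \<Rightarrow> ereal" where
  "set_indicator S X = (if X \<in> S then 0 else \<infinity>)"

definition exact_penalty :: "real \<Rightarrow> real^'n^'n \<Rightarrow> ereal" where
  "exact_penalty \<rho> X = ereal (\<rho> * max 0 (lambda_max (- X)))"

definition penalised_objective ::
    "real^'n^'n \<Rightarrow> (real^'n^'n \<Rightarrow> ereal) \<Rightarrow> real^'n^'n \<Rightarrow> ereal" where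
  "penalised_objective C g X = ereal (trace_inner C X) + g X"

end

theory Submission
  imports Defs
begin

text \<open>
  Let \<open>F\<close> be the face of the positive semidefinite cone formed by the matrices orthogonal to
  \<open>Zbar\<close>. It is the normal cone occurring in strict complementarity
  (\<open>normal_cone_polar_psd\<close>), and strong duality makes its intersection with the affine space
  of the equality constraints consist of primal solutions. So the theorem bounds the distance to
  the intersection of a face and an affine space, and it rests on two estimates.

  First, the face is approached with order one half: a positive semidefinite \<open>X\<close> has squared
  distance to \<open>F\<close> at most a constant times \<open>trace X\<close> times the slack
  \<open>Zbar \<bullet> X\<close> (\<open>psd_face_distance\<close>). This is where the exponent two comes from: by
  Cauchy--Schwarz, the off-diagonal block of \<open>X\<close> with respect to the kernel of \<open>Zbar\<close>
  is of the order of the square root of the diagonal block on the orthogonal complement, and that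
  block is controlled by the slack.

  Second, \<open>F\<close> and the affine space intersect regularly, because strict complementarity puts
  \<open>Xbar\<close> in the relative interior of \<open>F\<close>: a point of \<open>F\<close> has distance to the
  intersection at most a constant times its constraint residual, on bounded sets
  (\<open>convex_slice_regularity\<close>).

  Together they bound the squared distance of any symmetric \<open>X\<close> in a ball to the solution set
  by the residual of \<open>X\<close>, the displacement to a positive semidefinite substitute
  \<open>X'\<close>, and the slack of \<open>X'\<close> (\<open>psd_face_error_bound\<close>). Since the slack is the
  objective gap up to the residual, taking for \<open>X'\<close> the shift of \<open>X\<close> by a multiple of the
  identity gives the penalty inequality, and taking the nearest point of the cone gives the one
  with the distance term (\<open>sdp_quadratic_growth\<close>). The condition \<open>\<rho> > trace Zbar\<close> says that
  the penalty outweighs the slack created by the shift.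

  If the solution set is bounded, so are the sublevel sets, by convexity and the growth already
  established on balls (\<open>penalised_sublevel_bounded\<close>).
\<close>

section \<open>Positive semidefinite matrices\<close>

lemma subspace_sym_mats: "subspace sym_mats"
  unfolding sym_mats_def
  by (auto simp: subspace_def transpose_scalar) (auto simp: transpose_def vec_eq_iff)

lemma sym_mats_dot: "X \<in> sym_mats \<Longrightarrow> (X *v u) \<bullet> v = u \<bullet> (X *v v)"
  by (metis (mono_tags, lifting) dot_lmul_matrix mem_Collect_eq sym_mats_def transpose_matrix_vector)

lemma sym_matsI_dot:
  fixes X :: "real^'n^'n"
  assumes "\<And>u v. (X *v u) \<bullet> v = u \<bullet> (X *v v)"
  shows "X \<in> sym_mats"
proof -
  have "transpose X *v u = X *v u" for u
    by (rule vector_eq_rdot[THEN iffD1]) (simp add: dot_lmul_matrix assms)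
  then show ?thesis
    unfolding sym_mats_def by (simp add: matrix_eq)
qed

lemma trace_eq_inner_mat: "trace X = X \<bullet> (mat 1 :: real^'n^'n)"
  by (simp add: trace_def inner_vec_def mat_def if_distrib cong: if_cong)

lemma scaleR_mat_vector: "(t *\<^sub>R mat 1) *v v = t *\<^sub>R (v :: real^'n)"
  by (simp flip: scaleR_matrix_vector_assoc)

lemma mat_in_sym: "mat 1 \<in> sym_mats"
  by (simp add: sym_mats_def transpose_mat)

lemma psd_sym: "X \<in> psd_cone \<Longrightarrow> X \<in> sym_mats"
  by (simp add: psd_cone_def)

lemma psd_nonneg: "X \<in> psd_cone \<Longrightarrow> 0 \<le> v \<bullet> (X *v v)"
  by (simp add: psd_cone_def)

lemma psd_zero: "0 \<in> psd_cone"
  using subspace_0[OF subspace_sym_mats] by (simp add: psd_cone_def)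

lemma psd_add: "X \<in> psd_cone \<Longrightarrow> Y \<in> psd_cone \<Longrightarrow> X + Y \<in> psd_cone"
  by (simp add: psd_cone_def subspace_add[OF subspace_sym_mats] matrix_vector_mult_add_rdistrib
      inner_add_right)

lemma psd_scaleR: "X \<in> psd_cone \<Longrightarrow> 0 \<le> c \<Longrightarrow> c *\<^sub>R X \<in> psd_cone"
  by (simp add: psd_cone_def subspace_scale[OF subspace_sym_mats] flip: scaleR_matrix_vector_assoc)

lemma psd_mat: "mat 1 \<in> psd_cone"
  by (simp add: psd_cone_def mat_in_sym)

lemma closed_sym_mats: "closed sym_mats"
  by (rule closed_subspace[OF subspace_sym_mats])

lemma closed_psd_cone: "closed (psd_cone :: (real^'n^'n) set)"
proof -
  have eq: "psd_cone = sym_mats \<inter> (\<Inter>v. {X :: real^'n^'n. 0 \<le> v \<bullet> (X *v v)})"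
    by (auto simp: psd_cone_def)
  have "continuous_on UNIV (\<lambda>X :: real^'n^'n. v \<bullet> (X *v v))" for v
    unfolding matrix_vector_mult_def inner_vec_def by (intro continuous_intros)
  then have "closed {X :: real^'n^'n. 0 \<le> v \<bullet> (X *v v)}" for v
    by (intro closed_Collect_le continuous_on_const)
  then show ?thesis
    unfolding eq by (intro closed_Int closed_sym_mats closed_INT ballI)
qed

lemma psd_Cauchy_Schwarz:
  assumes "X \<in> psd_cone"
  shows "(u \<bullet> (X *v v))\<^sup>2 \<le> (u \<bullet> (X *v u)) * (v \<bullet> (X *v v))"
proof -
  define a c d where "a = u \<bullet> (X *v u)" and "c = u \<bullet> (X *v v)" and "d = v \<bullet> (X *v v)"
  have vu: "v \<bullet> (X *v u) = c"
    using sym_mats_dot[OF psd_sym[OF assms], of u v] by (simp add: c_def inner_commute)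
  have quad: "0 \<le> a + 2 * s * c + s\<^sup>2 * d" for s
    using psd_nonneg[OF assms, of "u + s *\<^sub>R v"]
    by (simp add: matrix_vector_right_distrib matrix_scaleR_vector_ac inner_add_left inner_add_right vu
        flip: a_def c_def d_def scaleR_matrix_vector_assoc)
       (simp add: algebra_simps power2_eq_square)
  have "0 \<le> d"
    using psd_nonneg[OF assms] by (simp add: d_def)
  then consider "d > 0" | "d = 0" by linarith
  then have "c\<^sup>2 \<le> a * d"
  proof cases
    case 1
    then show ?thesis
      using quad[of "- c / d"] by (simp add: field_simps power2_eq_square)
  next
    case 2
    have "c = 0"
    proof (rule ccontr)
      assume "c \<noteq> 0"
      then show False
        using quad[of "- (a + 1) / (2 * c)"] 2 by (simp add: field_simps)
    qed
    with 2 show ?thesis by simp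
  qed
  then show ?thesis by (simp add: a_def c_def d_def)
qed

lemma matrix_diagonal_nth: "X $ i $ i = axis i 1 \<bullet> (X *v (axis i 1 :: real^'n))"
  by (simp add: inner_axis' matrix_vector_mult_basis column_def)

text \<open>
  Expanding \<open>X *v v\<close> in the standard basis reduces this to the Cauchy--Schwarz inequality for
  the form of \<open>X\<close>; as matrices, \<open>X\<^sup>2\<close> is dominated by \<open>trace X\<close> times \<open>X\<close>. It is
  the tool that turns first-order information on a quadratic form into second-order information
  on vectors; in particular \<open>v \<bullet> (X *v v) = 0\<close> forces \<open>X *v v = 0\<close>.
\<close>

lemma psd_norm_mult_vec_le:
  fixes X :: "real^'n^'n"
  assumes "X \<in> psd_cone"
  shows "(norm (X *v v))\<^sup>2 \<le> trace X * (v \<bullet> (X *v v))"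
proof -
  have "(norm (X *v v))\<^sup>2 = (\<Sum>i\<in>UNIV. (axis i 1 \<bullet> (X *v v))\<^sup>2)"
    unfolding power2_norm_eq_inner inner_vec_def[of "X *v v"]
    by (simp add: power2_eq_square inner_axis')
  also have "\<dots> \<le> (\<Sum>i\<in>UNIV. X $ i $ i * (v \<bullet> (X *v v)))"
    unfolding matrix_diagonal_nth by (rule sum_mono) (rule psd_Cauchy_Schwarz[OF assms])
  finally show ?thesis
    by (simp add: trace_def sum_distrib_right)
qed

lemma psd_null_vector: "X \<in> psd_cone \<Longrightarrow> v \<bullet> (X *v v) = 0 \<Longrightarrow> X *v v = 0"
  using psd_norm_mult_vec_le[of X v] by simp

lemma psd_trace_nonneg: "X \<in> psd_cone \<Longrightarrow> 0 \<le> trace X"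
  unfolding trace_def matrix_diagonal_nth by (intro sum_nonneg psd_nonneg)

definition outer_square :: "real^'n \<Rightarrow> real^'n^'n" where
  "outer_square w = (\<chi> i j. w $ i * w $ j)"

lemma outer_square_mult_vec: "outer_square w *v v = (w \<bullet> v) *\<^sub>R w"
  by (simp add: outer_square_def matrix_vector_mult_def vec_eq_iff inner_vec_def
      sum_distrib_left sum_distrib_right algebra_simps)

lemma inner_outer_square: "X \<bullet> outer_square w = w \<bullet> (X *v w)"
  by (simp add: outer_square_def matrix_vector_mult_def inner_vec_def sum_distrib_left algebra_simps)

lemma outer_square_psd: "outer_square w \<in> psd_cone"
  by (simp add: psd_cone_def sym_mats_def outer_square_mult_vec)
     (simp add: outer_square_def transpose_def vec_eq_iff mult.commute inner_commute)

lemma norm_outer_square: "norm (outer_square w) = (norm w)\<^sup>2"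
proof -
  have "(norm (outer_square w))\<^sup>2 = ((norm w)\<^sup>2)\<^sup>2"
    unfolding power2_norm_eq_inner
    by (simp add: inner_outer_square outer_square_mult_vec power2_eq_square)
  then show ?thesis
    by (rule power2_eq_imp_eq) simp_all
qed

text \<open>
  Cholesky elimination, showing that the cone is contained in its dual cone: if the \<open>j\<close>th
  diagonal entry of \<open>X\<close> is positive, subtracting the rank-one matrix that clears the
  \<open>j\<close>th row and column leaves a positive semidefinite matrix (by Cauchy--Schwarz) and does not
  increase the inner product with \<open>Y\<close>; if the entry is zero, the row and
  column vanish already. After all indices only the zero matrix remains.
\<close>

lemma psd_inner_nonneg:
  fixes X Y :: "real^'n^'n"
  assumes "X \<in> psd_cone" and Y: "Y \<in> psd_cone"
  shows "0 \<le> X \<bullet> Y"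
proof -
  have "0 \<le> X \<bullet> Y" if "finite J" "X \<in> psd_cone" "\<And>j. j \<notin> J \<Longrightarrow> X *v axis j 1 = 0"
    for J and X :: "real^'n^'n"
    using that
  proof (induction J arbitrary: X rule: finite_induct)
    case empty
    then have "X $ i $ j = 0" for i j
      by (metis empty_iff matrix_vector_mult_basis column_def vec_lambda_beta zero_index)
    then have "X = 0" by (simp add: vec_eq_iff)
    then show ?case by simp
  next
    case (insert j J)
    define e :: "real^'n" where "e = axis j 1"
    define a where "a = e \<bullet> (X *v e)"
    have "a \<ge> 0"
      using psd_nonneg insert.prems by (simp add: a_def)
    show ?case
    proof (cases "a = 0")
      case True
      then have "X *v e = 0"
        using psd_null_vector insert.prems by (simp add: a_def)
      then have "X *v axis k 1 = 0" if "k \<notin> J" for k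
        using insert.prems(2) that by (cases "k = j") (auto simp: e_def)
      then show ?thesis
        using insert.IH insert.prems(1) by blast
    next
      case False
      with \<open>a \<ge> 0\<close> have a: "a > 0" by simp
      define w where "w = X *v e"
      define X' where "X' = X - (1 / a) *\<^sub>R outer_square w"
      have mult: "X' *v v = X *v v - ((w \<bullet> v) / a) *\<^sub>R w" for v
        by (simp add: X'_def matrix_vector_mult_diff_rdistrib outer_square_mult_vec
            flip: scaleR_matrix_vector_assoc)
      have w_dot: "w \<bullet> v = e \<bullet> (X *v v)" for v
        unfolding w_def using sym_mats_dot[OF psd_sym] insert.prems by blast
      have "X' \<in> psd_cone"
        unfolding psd_cone_def
      proof (intro CollectI conjI allI)
        show "X' \<in> sym_mats"
          unfolding X'_def
          by (intro subspace_diff subspace_scale subspace_sym_mats psd_sym outer_square_psd insert.prems)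
        fix v
        have "(w \<bullet> v)\<^sup>2 \<le> a * (v \<bullet> (X *v v))"
          unfolding w_dot a_def using psd_Cauchy_Schwarz insert.prems by blast
        then show "0 \<le> v \<bullet> (X' *v v)"
          using a by (simp add: mult inner_diff_right field_simps power2_eq_square inner_commute)
      qed
      moreover have "X' *v axis k 1 = 0" if "k \<notin> J" for k
      proof (cases "k = j")
        case True
        then show ?thesis
          using a w_dot[of e] by (simp add: mult a_def flip: e_def w_def)
      next
        case False
        with that have "X *v axis k 1 = 0" using insert.prems by simp
        then show ?thesis by (simp add: mult w_dot)
      qed
      ultimately have "0 \<le> X' \<bullet> Y"
        by (rule insert.IH)
      moreover have "X \<bullet> Y = X' \<bullet> Y + (1 / a) * (w \<bullet> (Y *v w))"
        unfolding X'_def inner_diff_left inner_scaleR_left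
        using inner_outer_square[of Y w] by (simp add: inner_commute)
      ultimately show ?thesis
        using psd_nonneg[OF Y, of w] a by simp
    qed
  qed
  from this[of UNIV X] assms show ?thesis by simp
qed

text \<open>
  Testing against rank-one matrices \<open>outer_square v\<close> recovers the quadratic form, so the dual
  cone is contained in the cone.
\<close>

lemma psd_if_inner_nonneg:
  assumes "X \<in> sym_mats" "\<And>W. W \<in> psd_cone \<Longrightarrow> 0 \<le> X \<bullet> W"
  shows "X \<in> psd_cone"
  using assms(1) assms(2)[OF outer_square_psd] by (simp add: psd_cone_def inner_outer_square)

section \<open>The least shift into the positive semidefinite cone\<close>

text \<open>
  The maximum of the Rayleigh quotient \<open>\<mu>\<close> exists by compactness of the sphere, and
  \<open>\<mu> I - Y\<close> is positive semidefinite by its choice. It bounds every eigenvalue and is one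
  itself. Eigenvectors for different eigenvalues are orthogonal, so there are finitely many
  eigenvalues, which is what makes \<open>Max\<close> in the definition of \<open>lambda_max\<close> meaningful.
\<close>

lemma lambda_max_attained:
  fixes Y :: "real^'n^'n"
  assumes "Y \<in> sym_mats"
  shows "\<exists>v. v \<noteq> 0 \<and> Y *v v = lambda_max Y *\<^sub>R v"
    and "lambda_max Y *\<^sub>R mat 1 - Y \<in> psd_cone"
proof -
  define E where "E = {l. \<exists>v. v \<noteq> 0 \<and> Y *v v = l *\<^sub>R v}"
  define vec where "vec l = (SOME v. v \<noteq> 0 \<and> Y *v v = l *\<^sub>R v)" for l
  have vec: "vec l \<noteq> 0 \<and> Y *v vec l = l *\<^sub>R vec l" if "l \<in> E" for l
    using that unfolding E_def vec_def by (metis (mono_tags, lifting) mem_Collect_eq someI)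
  have inj: "inj_on vec E"
  proof (rule inj_onI)
    fix k l assume "k \<in> E" "l \<in> E" "vec k = vec l"
    then show "k = l" using vec[of k] vec[of l] by (metis scaleR_cancel_right)
  qed
  have "pairwise orthogonal (vec ` E)"
  proof (clarsimp simp: pairwise_def orthogonal_def)
    fix k l assume kl: "k \<in> E" "l \<in> E" "vec k \<noteq> vec l"
    have "k * (vec k \<bullet> vec l) = l * (vec k \<bullet> vec l)"
      using sym_mats_dot[OF assms, of "vec k" "vec l"] vec[of k] vec[of l] kl by simp
    with kl show "vec k \<bullet> vec l = 0" by auto
  qed
  moreover have "0 \<notin> vec ` E" using vec by force
  ultimately have "finite (vec ` E)"
    using pairwise_orthogonal_independent independent_bound by blast
  then have fin: "finite E"
    using inj finite_image_iff by blast
  have "compact (sphere (0::real^'n) 1)" by simp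
  moreover have "axis undefined 1 \<in> sphere (0::real^'n) 1" by simp
  moreover have "continuous_on (sphere (0::real^'n) 1) (\<lambda>v. v \<bullet> (Y *v v))"
    by (intro continuous_intros linear_continuous_on linear_conv_bounded_linear[THEN iffD1]
        matrix_vector_mul_linear)
  ultimately obtain u where u: "norm u = 1"
      and max: "\<And>v. norm v = 1 \<Longrightarrow> v \<bullet> (Y *v v) \<le> u \<bullet> (Y *v u)"
    using continuous_attains_sup[of "sphere (0::real^'n) 1" "\<lambda>v. v \<bullet> (Y *v v)"] by fastforce
  define \<mu> where "\<mu> = u \<bullet> (Y *v u)"
  have bound: "v \<bullet> (Y *v v) \<le> \<mu> * (v \<bullet> v)" for v
  proof (cases "v = 0")
    case False
    then have "(1 / norm v)\<^sup>2 * (v \<bullet> (Y *v v)) \<le> \<mu>"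
      using max[of "(1 / norm v) *\<^sub>R v"]
      by (simp add: matrix_scaleR_vector_ac \<mu>_def power2_eq_square flip: scaleR_matrix_vector_assoc)
    with False show ?thesis
      by (simp add: power_divide divide_simps power2_norm_eq_inner mult.commute split: if_splits)
  qed simp
  have psd: "\<mu> *\<^sub>R mat 1 - Y \<in> psd_cone"
    using bound assms
    by (auto simp: psd_cone_def matrix_vector_mult_diff_rdistrib scaleR_mat_vector inner_diff_right
        intro!: subspace_diff subspace_scale subspace_sym_mats mat_in_sym)
  \<comment> \<open>A maximiser of the Rayleigh quotient is a null vector of \<open>\<mu> I - Y\<close>, hence an eigenvector.\<close>
  have "(\<mu> *\<^sub>R mat 1 - Y) *v u = 0"
    using u by (intro psd_null_vector[OF psd])
      (simp add: matrix_vector_mult_diff_rdistrib scaleR_mat_vector inner_diff_right \<mu>_def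
        norm_eq_1)
  then have eig: "u \<noteq> 0" "Y *v u = \<mu> *\<^sub>R u"
    using u by (auto simp: matrix_vector_mult_diff_rdistrib scaleR_mat_vector)
  have le: "l \<le> \<mu>" if "l \<in> E" for l
  proof -
    have "l * (vec l \<bullet> vec l) \<le> \<mu> * (vec l \<bullet> vec l)"
      using bound[of "vec l"] vec[OF that] by simp
    moreover have "0 < vec l \<bullet> vec l" using vec[OF that] by simp
    ultimately show ?thesis by simp
  qed
  have "\<mu> \<in> E" using eig by (auto simp: E_def)
  then have "Max E = \<mu>"
    using fin le by (intro Max_eqI) auto
  then have "lambda_max Y = \<mu>" by (simp add: lambda_max_def E_def)
  with eig psd show "\<exists>v. v \<noteq> 0 \<and> Y *v v = lambda_max Y *\<^sub>R v"
    "lambda_max Y *\<^sub>R mat 1 - Y \<in> psd_cone" by auto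
qed

text \<open>
  The penalty term without its factor; the next lemmas show that it is the least \<open>t \<ge> 0\<close>
  for which \<open>X + t I\<close> is positive semidefinite. Only this description is used afterwards.
\<close>

definition psd_shift :: "real^'n^'n \<Rightarrow> real" where
  "psd_shift X = max 0 (lambda_max (- X))"

lemma psd_shift_nonneg: "0 \<le> psd_shift X"
  by (simp add: psd_shift_def)

lemma psd_shift_psd:
  fixes X :: "real^'n^'n"
  assumes "X \<in> sym_mats"
  shows "X + psd_shift X *\<^sub>R mat 1 \<in> psd_cone"
proof -
  have "- X \<in> sym_mats" using assms subspace_neg[OF subspace_sym_mats] by blast
  then have "lambda_max (- X) *\<^sub>R mat 1 - (- X) \<in> psd_cone"
    by (rule lambda_max_attained)
  then have "(lambda_max (- X) *\<^sub>R mat 1 - (- X))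
      + (psd_shift X - lambda_max (- X)) *\<^sub>R mat 1 \<in> psd_cone"
    by (intro psd_add psd_scaleR psd_mat) (auto simp: psd_shift_def)
  then show ?thesis by (simp add: algebra_simps)
qed

lemma psd_shift_le:
  fixes X :: "real^'n^'n"
  assumes "X \<in> sym_mats" "0 \<le> t" "X + t *\<^sub>R mat 1 \<in> psd_cone"
  shows "psd_shift X \<le> t"
proof -
  have "- X \<in> sym_mats" using assms subspace_neg[OF subspace_sym_mats] by blast
  then obtain v where v: "v \<noteq> 0" "(- X) *v v = lambda_max (- X) *\<^sub>R v"
    using lambda_max_attained by blast
  have "(- X) *v v = - (X *v v)"
    using matrix_vector_mult_diff_rdistrib[of 0 X v] by simp
  with v have Xv: "X *v v = - lambda_max (- X) *\<^sub>R v"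
    by (metis minus_equation_iff scaleR_minus_left)
  have "0 \<le> v \<bullet> ((X + t *\<^sub>R mat 1) *v v)"
    by (rule psd_nonneg[OF assms(3)])
  also have "\<dots> = (t - lambda_max (- X)) * (v \<bullet> v)"
    by (simp add: matrix_vector_mult_add_rdistrib scaleR_mat_vector Xv algebra_simps)
  finally have "0 \<le> (t - lambda_max (- X)) * (v \<bullet> v)" .
  moreover have "0 < v \<bullet> v"
    using v(1) by simp
  ultimately have "lambda_max (- X) \<le> t"
    by (metis diff_ge_0_iff_ge linorder_not_le mult_neg_pos)
  with assms show ?thesis by (simp add: psd_shift_def)
qed

lemma psd_shift_le_norm:
  fixes X :: "real^'n^'n"
  assumes "X \<in> sym_mats"
  shows "psd_shift X \<le> norm X"
proof (rule psd_shift_le[OF assms])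
  have "- (v \<bullet> (X *v v)) \<le> norm X * (v \<bullet> v)" for v
    using Cauchy_Schwarz_ineq2[of X "outer_square v"]
    by (simp add: inner_outer_square norm_outer_square power2_norm_eq_inner)
  from this[THEN diff_ge_0_iff_ge[THEN iffD2]] have "0 \<le> v \<bullet> ((X + norm X *\<^sub>R mat 1) *v v)" for v
    by (simp add: matrix_vector_mult_add_rdistrib scaleR_mat_vector inner_add_right add.commute)
  then show "X + norm X *\<^sub>R mat 1 \<in> psd_cone"
    using assms by (auto simp: psd_cone_def
        intro!: subspace_add subspace_scale subspace_sym_mats mat_in_sym)
qed simp

lemma psd_shift_psd_eq_0: "X \<in> psd_cone \<Longrightarrow> psd_shift X = 0"
  using psd_shift_le[of X 0] psd_shift_nonneg[of X] by (simp add: psd_sym)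


section \<open>The face exposed by a dual slack matrix\<close>

definition psd_face :: "real^'n^'n \<Rightarrow> (real^'n^'n) set" where
  "psd_face Z = {Y \<in> psd_cone. Z \<bullet> Y = 0}"

lemma convex_psd_face: "convex (psd_face Z)"
  by (simp add: convex_def psd_face_def psd_add psd_scaleR inner_add_right)

lemma polar_psd_cone: "polar_cone psd_cone = uminus ` psd_cone"
proof -
  have "Y \<in> polar_cone psd_cone \<longleftrightarrow> - Y \<in> psd_cone" for Y :: "real^'n^'n"
  proof
    assume Y: "Y \<in> polar_cone psd_cone"
    then have "Y \<in> sym_mats" by (simp add: polar_cone_def)
    with Y show "- Y \<in> psd_cone"
      by (intro psd_if_inner_nonneg)
        (auto simp: polar_cone_def trace_inner_eq_inner subspace_neg[OF subspace_sym_mats])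
  next
    assume Y: "- Y \<in> psd_cone"
    then have sym: "Y \<in> sym_mats"
      using subspace_neg[OF subspace_sym_mats] psd_sym by fastforce
    then show "Y \<in> polar_cone psd_cone"
      using psd_inner_nonneg[OF Y] by (auto simp: polar_cone_def trace_inner_eq_inner)
  qed
  moreover have "Y \<in> uminus ` psd_cone \<longleftrightarrow> - Y \<in> psd_cone" for Y :: "real^'n^'n"
    using image_eqI[of Y uminus "- Y" psd_cone] by auto
  ultimately show ?thesis by blast
qed

text \<open>
  A normal vector at a point of a cone is orthogonal to that point, since the cone contains all
  of its nonnegative multiples. The remaining condition is membership in the dual cone, which is
  the cone of positive semidefinite matrices again.
\<close>

lemma normal_cone_polar_psd:
  fixes Z :: "real^'n^'n"
  assumes Z: "Z \<in> psd_cone"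
  shows "normal_cone (polar_cone psd_cone) (- Z) = psd_face Z"
proof -
  have "Y \<in> normal_cone (polar_cone psd_cone) (- Z) \<longleftrightarrow>
      Y \<in> sym_mats \<and> (\<forall>W\<in>psd_cone. Y \<bullet> (Z - W) \<le> 0)" for Y
    using Z by (auto simp: normal_cone_def polar_psd_cone trace_inner_eq_inner)
  moreover have "Y \<in> sym_mats \<and> (\<forall>W\<in>psd_cone. Y \<bullet> (Z - W) \<le> 0) \<longleftrightarrow> Y \<in> psd_face Z" for Y
  proof
    assume Y: "Y \<in> sym_mats \<and> (\<forall>W\<in>psd_cone. Y \<bullet> (Z - W) \<le> 0)"
    then have "Y \<bullet> (Z - 0) \<le> 0" "Y \<bullet> (Z - 2 *\<^sub>R Z) \<le> 0"
      using psd_zero psd_scaleR[OF Z, of 2] by auto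
    then have "Y \<bullet> Z = 0" by (simp add: inner_diff_right)
    moreover from this have "Y \<in> psd_cone"
      using Y by (intro psd_if_inner_nonneg) (auto simp: inner_diff_right)
    ultimately show "Y \<in> psd_face Z" by (simp add: psd_face_def inner_commute)
  next
    assume "Y \<in> psd_face Z"
    then show "Y \<in> sym_mats \<and> (\<forall>W\<in>psd_cone. Y \<bullet> (Z - W) \<le> 0)"
      using psd_inner_nonneg psd_sym by (auto simp: psd_face_def inner_diff_right inner_commute)
  qed
  ultimately show ?thesis by blast
qed

lemma linear_le_scaled_norm:
  assumes "linear (f :: 'a::euclidean_space \<Rightarrow> 'b::real_normed_vector)"
  obtains K where "K > 0" "\<And>x. norm (f x) \<le> K * norm x"
  using bounded_linear.pos_bounded[OF linear_conv_bounded_linear[THEN iffD1, OF assms]]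
  by (auto simp: mult.commute)

text \<open>
  A symmetric \<open>P\<close> with range in the kernel of \<open>Z\<close>, close to the identity where
  \<open>Z\<close> is small: the orthogonal projection onto the kernel, since \<open>Z\<close> is bounded
  below on the orthogonal complement of its kernel.
\<close>

lemma kernel_projection:
  fixes Z :: "real^'n^'n"
  assumes "Z \<in> sym_mats"
  obtains P c where "P \<in> sym_mats" "\<And>v. Z *v (P *v v) = 0" "c > 0"
    "\<And>v. norm (v - P *v v) \<le> c * norm (Z *v v)"
proof -
  define S where "S = {v. Z *v v = 0}"
  have S: "subspace S"
    by (simp add: S_def linear_subspace_kernel matrix_vector_mul_linear)
  obtain B where B: "0 \<notin> B" "B \<subseteq> S" "pairwise orthogonal B" "independent B" "span B = S"
    using orthogonal_basis_subspace[OF S] by metis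
  define p where "p v = (\<Sum>b\<in>B. (b \<bullet> v / (b \<bullet> b)) *\<^sub>R b)" for v
  have lin: "linear p"
    by (rule linearI) (simp_all add: p_def inner_add_right add_divide_distrib scaleR_add_left
        sum.distrib scaleR_sum_right)
  define P where "P = matrix p"
  have P: "P *v v = p v" for v
    using lin by (simp add: P_def matrix_works)
  have "P \<in> sym_mats"
    by (rule sym_matsI_dot)
      (simp add: P p_def inner_sum_left inner_sum_right inner_commute algebra_simps)
  moreover have pS: "p v \<in> S" for v
    unfolding p_def using B by (intro subspace_sum[OF S] subspace_scale[OF S]) auto
  then have ZP: "Z *v (P *v v) = 0" for v by (simp add: S_def P)
  moreover have "\<exists>e>0. \<forall>x\<in>{x. \<forall>b\<in>B. b \<bullet> x = 0}. e * norm x \<le> norm (Z *v x)"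
  proof (rule injective_imp_isometric)
    show sub: "subspace {x. \<forall>b\<in>B. b \<bullet> x = 0}"
      by (simp add: subspace_def inner_add_right)
    then show "closed {x. \<forall>b\<in>B. b \<bullet> x = 0}" by (rule closed_subspace)
    show "bounded_linear ((*v) Z)"
      by (simp add: matrix_vector_mul_bounded_linear)
    show "\<forall>x\<in>{x. \<forall>b\<in>B. b \<bullet> x = 0}. Z *v x = 0 \<longrightarrow> x = 0"
    proof clarify
      fix x assume x: "\<forall>b\<in>B. b \<bullet> x = 0" "Z *v x = 0"
      then have "x \<in> span B" using B by (simp add: S_def)
      then have "orthogonal x x"
        by (rule orthogonal_to_span) (use x in \<open>auto simp: orthogonal_def inner_commute\<close>)
      then show "x = 0" by (simp add: orthogonal_self)
    qed
  qed
  then obtain e where e: "e > 0" "\<And>x. (\<And>b. b \<in> B \<Longrightarrow> b \<bullet> x = 0) \<Longrightarrow> e * norm x \<le> norm (Z *v x)"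
    by blast
  have "norm (v - P *v v) \<le> (1 / e) * norm (Z *v v)" for v
  proof -
    have "b \<bullet> (v - p v) = 0" if "b \<in> B" for b
      using Gram_Schmidt_step[OF B(3) span_base[OF that], of v]
      by (simp add: p_def orthogonal_def)
    then have "e * norm (v - p v) \<le> norm (Z *v (v - p v))"
      by (rule e)
    then show ?thesis
      using e(1) ZP[of v] by (simp add: P matrix_vector_mult_diff_distrib field_simps)
  qed
  ultimately show ?thesis
    using that[of P "1 / e"] e(1) by simp
qed

lemma matrix_mult_vec_nth:
  fixes Q X :: "real^'n^'n"
  shows "(Q ** X) $ i = transpose X *v (Q $ i)"
  unfolding vec_eq_iff matrix_matrix_mult_def matrix_vector_mult_def transpose_def
  by (auto intro!: sum.cong simp: mult.commute)

text \<open>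
  The distance to the face is of the order of the square root of the slack. With \<open>P\<close> the
  projection onto the kernel of \<open>Z\<close> and \<open>Q = I - P\<close>, the matrix \<open>P X P\<close>
  lies in the face, and \<open>X - P X P\<close> is controlled by \<open>Q X\<close>. The rows of \<open>Q X\<close>
  are values of \<open>X\<close>, so that \<open>Q X\<close> has squared norm at most \<open>trace X\<close>
  times the inner product of \<open>Q\<^sup>2\<close> and \<open>X\<close>, and \<open>Q\<^sup>2\<close> is
  dominated by a multiple of \<open>Z\<close>.
\<close>

lemma psd_face_distance:
  fixes Z :: "real^'n^'n"
  assumes Z: "Z \<in> psd_cone"
  obtains c where "c > 0"
    "\<And>X. X \<in> psd_cone \<Longrightarrow> \<exists>Y\<in>psd_face Z. (norm (X - Y))\<^sup>2 \<le> c * trace X * (Z \<bullet> X)"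
proof -
  obtain P k where P: "P \<in> sym_mats" and ZP: "\<And>v. Z *v (P *v v) = 0" and k: "k > 0"
      and PZ: "\<And>v. norm (v - P *v v) \<le> k * norm (Z *v v)"
    using kernel_projection[OF psd_sym[OF Z]] by metis
  define Q where "Q = mat 1 - P"
  have Q: "Q \<in> sym_mats"
    unfolding Q_def by (intro subspace_diff subspace_sym_mats mat_in_sym P)
  have Qv: "Q *v v = v - P *v v" for v
    by (simp add: Q_def matrix_vector_mult_diff_rdistrib)
  define W where "W = (k\<^sup>2 * trace Z) *\<^sub>R Z - Q ** Q"
  have W: "W \<in> psd_cone"
    unfolding psd_cone_def
  proof (intro CollectI conjI allI)
    have "Q ** Q \<in> sym_mats"
      using Q by (simp add: sym_mats_def matrix_transpose_mul)
    with psd_sym[OF Z] show "W \<in> sym_mats"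
      unfolding W_def by (intro subspace_diff subspace_scale subspace_sym_mats)
    fix v
    have "v \<bullet> ((Q ** Q) *v v) = (norm (Q *v v))\<^sup>2"
      using sym_mats_dot[OF Q, of v "Q *v v"]
      by (simp add: power2_norm_eq_inner flip: matrix_vector_mul_assoc)
    also have "\<dots> \<le> (k * norm (Z *v v))\<^sup>2"
      unfolding Qv by (intro power_mono PZ) simp
    also have "\<dots> \<le> k\<^sup>2 * (trace Z * (v \<bullet> (Z *v v)))"
      unfolding power_mult_distrib by (intro mult_left_mono psd_norm_mult_vec_le Z) simp
    finally show "0 \<le> v \<bullet> (W *v v)"
      by (simp add: W_def matrix_vector_mult_diff_rdistrib inner_diff_right mult.assoc
          flip: scaleR_matrix_vector_assoc)
  qed
  have "linear (\<lambda>M. M + P ** transpose M)"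
    by (rule linearI) (auto simp: matrix_matrix_mult_def transpose_def vec_eq_iff sum.distrib
        sum_distrib_left algebra_simps)
  then obtain K where K: "K > 0" "\<And>M. norm (M + P ** transpose M) \<le> K * norm M"
    by (rule linear_le_scaled_norm) blast
  define c where "c = K\<^sup>2 * (k\<^sup>2 * trace Z + 1)"
  have "c > 0"
    unfolding c_def using K(1) psd_trace_nonneg[OF Z] by (intro mult_pos_pos add_nonneg_pos) auto
  moreover have "\<exists>Y\<in>psd_face Z. (norm (X - Y))\<^sup>2 \<le> c * trace X * (Z \<bullet> X)" if X: "X \<in> psd_cone" for X
  proof
    define Y where "Y = P ** X ** P"
    have tX: "transpose X = X" and tQ: "transpose Q = Q" and tP: "transpose P = P"
      using psd_sym[OF X] Q P by (auto simp: sym_mats_def)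
    have "Y \<in> psd_cone"
      unfolding psd_cone_def
    proof (intro CollectI conjI allI)
      show "Y \<in> sym_mats"
        by (simp add: Y_def sym_mats_def matrix_transpose_mul tX tP matrix_mul_assoc)
      fix v
      show "0 \<le> v \<bullet> (Y *v v)"
        using psd_nonneg[OF X, of "P *v v"] sym_mats_dot[OF P, of v "X *v (P *v v)"]
        by (simp add: Y_def flip: matrix_vector_mul_assoc)
    qed
    moreover have "Z \<bullet> Y = 0"
    proof -
      have "Z ** Y = (Z ** P) ** (X ** P)"
        by (simp add: Y_def matrix_mul_assoc)
      also have "Z ** P = 0"
        by (simp add: matrix_eq ZP flip: matrix_vector_mul_assoc)
      finally have "trace_inner Z Y = 0"
        by (simp add: trace_inner_def matrix_matrix_mult_def trace_def)
      then show ?thesis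
        using trace_inner_eq_inner[OF psd_sym[OF Z]] by simp
    qed
    ultimately show "Y \<in> psd_face Z" by (simp add: psd_face_def)
    have "norm (Q ** X)^2 = (\<Sum>i\<in>UNIV. (norm (X *v (Q $ i)))\<^sup>2)"
      by (simp add: norm_vec_def L2_set_def sum_nonneg matrix_mult_vec_nth tX)
    also have "\<dots> \<le> (\<Sum>i\<in>UNIV. trace X * (Q $ i \<bullet> (X *v (Q $ i))))"
      by (intro sum_mono psd_norm_mult_vec_le X)
    also have "\<dots> = trace X * (Q \<bullet> (Q ** X))"
      by (simp add: inner_vec_def[of Q] matrix_mult_vec_nth tX sum_distrib_left)
    also have "Q \<bullet> (Q ** X) = (Q ** Q) \<bullet> X"
    proof -
      have "Q ** Q \<in> sym_mats"
        using Q by (simp add: sym_mats_def matrix_transpose_mul)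
      then show ?thesis
        using Q by (simp add: matrix_mul_assoc trace_inner_def flip: trace_inner_eq_inner)
    qed
    also have "trace X * ((Q ** Q) \<bullet> X) \<le> trace X * ((k\<^sup>2 * trace Z) * (Z \<bullet> X))"
      using psd_inner_nonneg[OF W X] psd_trace_nonneg[OF X]
      by (intro mult_left_mono) (auto simp: W_def inner_diff_left)
    finally have QX: "norm (Q ** X)^2 \<le> trace X * ((k\<^sup>2 * trace Z) * (Z \<bullet> X))" .
    have "X - Y = Q ** X + P ** transpose (Q ** X)"
      by (simp add: matrix_transpose_mul tX tQ)
        (simp add: matrix_eq Y_def Qv matrix_vector_mult_diff_rdistrib matrix_vector_mult_add_rdistrib
          matrix_vector_mult_diff_distrib flip: matrix_vector_mul_assoc)
    then have "norm (X - Y) \<le> K * norm (Q ** X)"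
      using K by simp
    then have "norm (X - Y)^2 \<le> K\<^sup>2 * (norm (Q ** X))\<^sup>2"
      by (metis norm_ge_zero power_mono power_mult_distrib)
    also have "\<dots> \<le> K\<^sup>2 * (trace X * ((k\<^sup>2 * trace Z) * (Z \<bullet> X)))"
      by (intro mult_left_mono QX) simp
    also have "\<dots> \<le> c * trace X * (Z \<bullet> X)"
      using psd_inner_nonneg[OF Z X] psd_trace_nonneg[OF X] by (simp add: c_def algebra_simps)
    finally show "norm (X - Y)^2 \<le> c * trace X * (Z \<bullet> X)" .
  qed
  ultimately show ?thesis using that by blast
qed

section \<open>Regularity of affine slices of convex sets\<close>

text \<open>
  A point \<open>y\<close> of a convex set that nearly satisfies \<open>f y = f x0\<close> is near a point of
  the set that satisfies it exactly. A bounded right inverse of \<open>f\<close> on the affine hull gives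
  a small correction \<open>w\<close>, but \<open>y - w\<close> may leave the set. Mixing \<open>y\<close> with a
  point \<open>u\<close> obtained from the relative interior point \<open>x0\<close> by moving a distance
  \<open>e\<close> in the direction \<open>- w\<close> cancels the error inside the set, and the weight of
  \<open>u\<close> is only of the order of \<open>norm w\<close>.
\<close>

lemma convex_slice_regularity:
  fixes f :: "'a::euclidean_space \<Rightarrow> 'b::euclidean_space"
  assumes f: "linear f" and F: "convex F" and x0: "x0 \<in> rel_interior F"
  obtains K where "K > 0"
    "\<And>y. y \<in> F \<Longrightarrow> \<exists>x\<in>F. f x = f x0 \<and> norm (y - x) \<le> K * (1 + norm (y - x0)) * norm (f y - f x0)"
proof -
  obtain e where e: "e > 0" "cball x0 e \<inter> affine hull F \<subseteq> F" and x0F: "x0 \<in> F"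
    using x0 by (auto simp: mem_rel_interior_cball)
  define S where "S = (\<lambda>x. x - x0) ` (affine hull F)"
  have hull: "x0 \<in> affine hull F" using x0F by (rule hull_inc)
  have S: "subspace S"
    unfolding S_def by (rule affine_diffs_subspace_subtract[OF affine_affine_hull hull])
  obtain h where h: "range h \<subseteq> S" "linear h" "\<And>v. v \<in> f ` S \<Longrightarrow> f (h v) = v"
    using linear_exists_right_inverse_on[OF f S] by auto
  obtain B where B: "B > 0" "\<And>v. norm (h v) \<le> B * norm v"
    using h(2) by (rule linear_le_scaled_norm) blast
  define K where "K = B * (1 + 1 / e)"
  have "K > 0" unfolding K_def using B(1) e(1) by (intro mult_pos_pos add_pos_pos) auto
  moreover have "\<exists>x\<in>F. f x = f x0 \<and> norm (y - x) \<le> K * (1 + norm (y - x0)) * norm (f y - f x0)"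
    if y: "y \<in> F" for y
  proof -
    define w where "w = h (f y - f x0)"
    define n where "n = norm w"
    have "y - x0 \<in> S" using y by (auto simp: S_def hull_inc)
    then have fw: "f w = f y - f x0"
      unfolding w_def using h(3) f by (metis image_eqI linear_diff)
    have n: "n \<le> B * norm (f y - f x0)" by (simp add: n_def w_def B)
    show ?thesis
    proof (cases "n = 0")
      case True
      then have "f y = f x0" using fw f by (simp add: n_def linear_0)
      with y show ?thesis by (intro bexI[of _ y]) auto
    next
      case False
      then have n0: "n > 0" by (simp add: n_def)
      define t where "t = e / (e + n)"
      have t: "0 \<le> t" "t \<le> 1" "1 - t = n / (e + n)" "(1 - t) * (e / n) = t"
        using e(1) n0 by (auto simp: t_def field_simps)
      define u where "u = x0 - (e / n) *\<^sub>R w"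
      have "w \<in> S" using h(1) by (auto simp: w_def)
      then have "- ((e / n) *\<^sub>R w) \<in> S"
        by (intro subspace_neg subspace_scale S)
      then have "u \<in> affine hull F"
        by (auto simp: S_def u_def algebra_simps)
      moreover have "u \<in> cball x0 e"
        using e(1) n0 by (simp add: u_def dist_norm flip: n_def)
      ultimately have u: "u \<in> F" using e(2) by blast
      define x where "x = t *\<^sub>R y + (1 - t) *\<^sub>R u"
      have "(1 - t) *\<^sub>R ((e / n) *\<^sub>R w) = t *\<^sub>R w"
        using t(4) by (metis scaleR_scaleR)
      then have x: "x = t *\<^sub>R y + (1 - t) *\<^sub>R x0 - t *\<^sub>R w"
        by (simp only: x_def u_def scaleR_diff_right add_diff_eq)
      have "x \<in> F"
        unfolding x_def using F y u t by (intro convexD) auto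
      moreover have "f x = f x0"
        using f by (simp add: x linear_diff linear_add linear_scale fw algebra_simps)
      moreover have "norm (y - x) \<le> K * (1 + norm (y - x0)) * norm (f y - f x0)"
      proof -
        have "y - x = (1 - t) *\<^sub>R (y - x0) + t *\<^sub>R w"
          by (simp add: x algebra_simps)
        then have "norm (y - x) \<le> norm ((1 - t) *\<^sub>R (y - x0)) + norm (t *\<^sub>R w)"
          by (simp only: norm_triangle_ineq)
        also have "\<dots> = (1 - t) * norm (y - x0) + t * n"
          using t(1,2) by (simp add: n_def)
        also have "\<dots> \<le> (n / e) * norm (y - x0) + 1 * n"
        proof -
          have "1 - t \<le> n / e"
            unfolding t(3) using e(1) n0 by (intro divide_left_mono) auto
          with t(2) n0 show ?thesis
            by (intro add_mono mult_right_mono) auto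
        qed
        also have "\<dots> \<le> n * ((1 + 1 / e) * (1 + norm (y - x0)))"
          using e(1) n0 mult_nonneg_nonneg[of n "norm (y - x0)"] divide_nonneg_nonneg[of n e]
          by (simp add: algebra_simps)
        also have "\<dots> \<le> (B * norm (f y - f x0)) * ((1 + 1 / e) * (1 + norm (y - x0)))"
          using e(1) n by (intro mult_right_mono mult_nonneg_nonneg) auto
        finally show ?thesis by (simp add: K_def mult_ac)
      qed
      ultimately show ?thesis by blast
    qed
  qed
  ultimately show ?thesis using that by blast
qed


section \<open>Quadratic error bounds\<close>

lemma power2_sum3_le: "(a + b + c)\<^sup>2 \<le> 3 * (a\<^sup>2 + b\<^sup>2 + (c::real)\<^sup>2)"
proof -
  have "0 \<le> (a - b)\<^sup>2 + (b - c)\<^sup>2 + (a - c)\<^sup>2" by simp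
  then show ?thesis by (simp add: power2_eq_square algebra_simps)
qed

text \<open>
  The optimal face is reached in two steps: from \<open>X'\<close> to the face, then within the face to
  the slice of correct \<open>f\<close>-value. The slack enters the square linearly, because the distance
  to the face is of the order of its square root. The residual and \<open>X - X'\<close> enter the distance
  itself linearly, so that their squares are at most multiples of themselves on bounded sets.
\<close>

lemma psd_face_error_bound:
  fixes f :: "real^'n^'n \<Rightarrow> 'b::euclidean_space" and Z :: "real^'n^'n"
  assumes f: "linear f" and Z: "Z \<in> psd_cone" and Xbar: "Xbar \<in> rel_interior (psd_face Z)"
    and R: "R > 0"
  obtains K where "K > 0"
    "\<And>X X'. norm X \<le> R \<Longrightarrow> X' \<in> psd_cone \<Longrightarrow> norm X' \<le> R \<Longrightarrow>
      \<exists>Y\<in>psd_face Z. f Y = f Xbar \<and>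
        (norm (X - Y))\<^sup>2 \<le> K * (norm (f X - f Xbar) + norm (X - X') + Z \<bullet> X')"
proof -
  obtain c where c: "c > 0" and face: "\<And>X. X \<in> psd_cone \<Longrightarrow>
      \<exists>Y\<in>psd_face Z. (norm (X - Y))\<^sup>2 \<le> c * trace X * (Z \<bullet> X)"
    using psd_face_distance[OF Z] by metis
  obtain k where k: "k > 0" and slice: "\<And>Y. Y \<in> psd_face Z \<Longrightarrow>
      \<exists>V\<in>psd_face Z. f V = f Xbar \<and>
        norm (Y - V) \<le> k * (1 + norm (Y - Xbar)) * norm (f Y - f Xbar)"
    using convex_slice_regularity[OF f convex_psd_face Xbar] by metis
  obtain B where B: "B > 0" "\<And>X. norm (f X) \<le> B * norm X"
    using f by (rule linear_le_scaled_norm) blast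
  define N where "N = norm (mat 1 :: real^'n^'n)"
  have N: "N \<ge> 0" by (simp add: N_def)
  \<comment> \<open>On the ball of radius \<open>R\<close>, the squared distance to the face is at most \<open>c1\<close>
      times the slack, and the distance itself at most \<open>q\<close>.\<close>
  define c1 where "c1 = c * (N * R)"
  have c1: "c1 \<ge> 0" using c R by (simp add: c1_def N)
  define q where "q = sqrt (c1 * (norm Z * R))"
  have q: "q \<ge> 0" unfolding q_def using c1 R by simp
  \<comment> \<open>\<open>L\<close> is the Lipschitz factor of the correction inside the face, \<open>M\<close> collects the
      linear errors, and \<open>D\<close> bounds the first two of them, so that squares can be linearised.\<close>
  define L where "L = k * (1 + (q + R + norm Xbar))"
  have L: "L > 0" unfolding L_def using k q R by (intro mult_pos_pos add_pos_nonneg) auto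
  define M where "M = L + 1 + L * B"
  have M: "M > 0" unfolding M_def using L B(1) by (intro add_pos_pos mult_pos_pos) auto
  define D where "D = B * R + norm (f Xbar) + 2 * R + c1"
  have D: "D > 0" unfolding D_def using B(1) R c1 by (intro add_pos_nonneg add_nonneg_pos) auto
  define K where "K = 3 * M\<^sup>2 * D"
  have "K > 0" unfolding K_def using M D by simp
  moreover have "\<exists>Y\<in>psd_face Z. f Y = f Xbar \<and>
      (norm (X - Y))\<^sup>2 \<le> K * (norm (f X - f Xbar) + norm (X - X') + Z \<bullet> X')"
    if X: "norm X \<le> R" and X': "X' \<in> psd_cone" "norm X' \<le> R" for X X'
  proof -
    define s e z where "s = norm (f X - f Xbar)" and "e = norm (X - X')" and "z = Z \<bullet> X'"
    have z: "z \<ge> 0" unfolding z_def by (rule psd_inner_nonneg[OF Z X'(1)])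
    obtain Y where Y: "Y \<in> psd_face Z" "(norm (X' - Y))\<^sup>2 \<le> c * trace X' * (Z \<bullet> X')"
      using face[OF X'(1)] by blast
    have "trace X' \<le> norm X' * N"
      unfolding trace_eq_inner_mat N_def by (rule norm_cauchy_schwarz)
    also have "\<dots> \<le> N * R"
      using X'(2) N by (simp add: mult.commute mult_left_mono)
    finally have "c * trace X' * (Z \<bullet> X') \<le> c1 * z"
      unfolding c1_def z_def[symmetric] using c z by (intro mult_right_mono mult_left_mono) auto
    with Y have d2: "(norm (X' - Y))\<^sup>2 \<le> c1 * z" by simp
    define d where "d = norm (X' - Y)"
    have "z \<le> norm Z * norm X'"
      unfolding z_def by (rule norm_cauchy_schwarz)
    also have "\<dots> \<le> norm Z * R"
      using X'(2) by (intro mult_left_mono) auto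
    finally have "c1 * z \<le> c1 * (norm Z * R)"
      using c1 by (intro mult_left_mono)
    with d2 have dq: "d \<le> q"
      unfolding q_def d_def by (intro real_le_rsqrt) simp
    have "norm (Y - Xbar) \<le> d + norm X' + norm Xbar"
      unfolding d_def using norm_triangle_ineq4[of Y Xbar] norm_triangle_ineq4[of X' "X' - Y"] by simp
    with dq X'(2) have YX: "norm (Y - Xbar) \<le> q + R + norm Xbar" by simp
    obtain V where V: "V \<in> psd_face Z" "f V = f Xbar"
        "norm (Y - V) \<le> k * (1 + norm (Y - Xbar)) * norm (f Y - f Xbar)"
      using slice[OF Y(1)] by blast
    have "norm (f Y - f Xbar) \<le> s + B * (e + d)"
    proof -
      have "f Y - f Xbar = (f X - f Xbar) - f (X - Y)"
        using f by (simp add: linear_diff)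
      then have "norm (f Y - f Xbar) \<le> s + norm (f (X - Y))"
        unfolding s_def by (simp only: norm_triangle_ineq4)
      also have "norm (f (X - Y)) \<le> B * norm (X - Y)" by (rule B)
      also have "norm (X - Y) \<le> e + d"
        unfolding e_def d_def using norm_triangle_ineq[of "X - X'" "X' - Y"] by simp
      finally show ?thesis using B(1) by (simp add: mult_left_mono)
    qed
    moreover have "k * (1 + norm (Y - Xbar)) \<le> L"
      unfolding L_def using k YX by (intro mult_left_mono) auto
    ultimately have "k * (1 + norm (Y - Xbar)) * norm (f Y - f Xbar) \<le> L * (s + B * (e + d))"
      using L by (intro mult_mono) auto
    with V have YV: "norm (Y - V) \<le> L * (s + B * (e + d))" by simp
    have nn: "0 \<le> s" "0 \<le> e" "0 \<le> d" by (auto simp: s_def e_def d_def)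
    have "norm (X - V) \<le> e + d + norm (Y - V)"
      unfolding e_def d_def
      using norm_triangle_ineq[of "X - X'" "X' - V"] norm_triangle_ineq[of "X' - Y" "Y - V"] by simp
    also have "\<dots> \<le> M * (s + e + d)"
    proof -
      have "M * (s + e + d) = (e + d + L * (s + B * (e + d))) + (L * (e + d) + s + L * B * s)"
        by (simp add: M_def algebra_simps)
      moreover have "0 \<le> L * (e + d) + s + L * B * s"
        using nn L B(1) by simp
      ultimately show ?thesis using YV by simp
    qed
    finally have "(norm (X - V))\<^sup>2 \<le> (M * (s + e + d))\<^sup>2"
      by (intro power_mono) auto
    also have "\<dots> \<le> M\<^sup>2 * (3 * (s\<^sup>2 + e\<^sup>2 + d\<^sup>2))"
      unfolding power_mult_distrib by (intro mult_left_mono power2_sum3_le) simp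
    also have "\<dots> \<le> M\<^sup>2 * (3 * (D * (s + e + z)))"
    proof -
      have "s \<le> norm (f X) + norm (f Xbar)"
        unfolding s_def by (rule norm_triangle_ineq4)
      also have "norm (f X) \<le> B * R"
        using B(2)[of X] mult_left_mono[OF X less_imp_le[OF B(1)]] by (rule order_trans)
      finally have "s \<le> D" using R c1 by (simp add: D_def)
      moreover have "e \<le> 2 * R"
        unfolding e_def using norm_triangle_ineq4[of X X'] X X'(2) by simp
      then have "e \<le> D"
        using mult_pos_pos[OF B(1) R] c1 by (simp add: D_def add_increasing add_increasing2)
      moreover have "c1 \<le> D"
        using mult_pos_pos[OF B(1) R] R by (simp add: D_def add_increasing add_increasing2)
      ultimately have "s * s \<le> D * s" "e * e \<le> D * e" "c1 * z \<le> D * z"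
        using nn z by (auto intro!: mult_right_mono)
      then have "s\<^sup>2 + e\<^sup>2 + d\<^sup>2 \<le> D * (s + e + z)"
        using d2 by (simp add: power2_eq_square algebra_simps flip: d_def)
      then show ?thesis by (intro mult_left_mono) auto
    qed
    finally have "(norm (X - V))\<^sup>2 \<le> K * (s + e + z)"
      by (simp add: K_def algebra_simps)
    with V show ?thesis
      unfolding s_def e_def z_def by blast
  qed
  ultimately show ?thesis using that by blast
qed

lemma linear_constr_map:
  assumes "\<And>i. A i \<in> sym_mats"
  shows "linear (constr_map A)"
  by (rule linearI) (simp_all add: constr_map_def trace_inner_eq_inner[OF assms] vec_eq_iff inner_add_right)

text \<open>
  The objective exceeds its optimal value by the complementarity slack, up to a term linear in the
  residual of the equality constraints.
\<close>

lemma dual_slack_identity: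
  assumes A: "\<And>i. A i \<in> sym_mats" and C: "C \<in> sym_mats" and dual: "constr_adj A y + Z = C"
  shows "Z \<bullet> X = trace_inner C X - b \<bullet> y - y \<bullet> (constr_map A X - b)"
proof -
  have "constr_adj A y \<bullet> X = y \<bullet> constr_map A X"
    by (simp add: constr_adj_def constr_map_def inner_sum_left trace_inner_eq_inner[OF A]
        inner_vec_def[of y])
  moreover have "trace_inner C X = constr_adj A y \<bullet> X + Z \<bullet> X"
    by (simp add: trace_inner_eq_inner[OF C] dual flip: inner_add_left)
  ultimately show ?thesis
    by (simp add: inner_diff_right inner_commute)
qed

text \<open>
  The geometric content of the two hypotheses. By strict complementarity, \<open>Xbar\<close> is a feasible
  point in the relative interior of the face exposed by \<open>Z\<close>. By strong duality the slack is the
  objective gap of a feasible point, so that every feasible point of that face is optimal.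
\<close>

lemma strict_complementary_optimum:
  fixes C :: "real^'n^'n" and A :: "'m::finite \<Rightarrow> real^'n^'n"
  assumes C: "C \<in> sym_mats" and A: "\<And>i. A i \<in> sym_mats"
    and sd: "strong_duality C A b" and dsc: "dual_strict_complementary C A b Xbar y Z"
  shows "primal_value C A b = ereal (b \<bullet> y)" and "Z \<in> psd_cone" and "constr_adj A y + Z = C"
    and "Xbar \<in> primal_solutions C A b" and "Xbar \<in> rel_interior (psd_face Z)"
    and "constr_map A Xbar = b"
    and "\<And>Y. Y \<in> psd_face Z \<Longrightarrow> constr_map A Y = b \<Longrightarrow> Y \<in> primal_solutions C A b"
proof -
  have Xbar: "Xbar \<in> primal_solutions C A b" and y: "(y, Z) \<in> dual_solutions C A b"
    and ri: "Xbar \<in> rel_interior (normal_cone (polar_cone psd_cone) (- Z))"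
    using dsc by (auto simp: dual_strict_complementary_def)
  from y have Z: "Z \<in> psd_cone" and dual: "constr_adj A y + Z = C"
    and "ereal (b \<bullet> y) = dual_value C A b"
    by (auto simp: dual_solutions_def)
  with sd show val: "primal_value C A b = ereal (b \<bullet> y)"
    by (simp add: strong_duality_def)
  show "Z \<in> psd_cone" "constr_adj A y + Z = C" "Xbar \<in> primal_solutions C A b" by fact+
  show "Xbar \<in> rel_interior (psd_face Z)"
    using ri by (simp add: normal_cone_polar_psd[OF Z])
  show "constr_map A Xbar = b"
    using Xbar by (simp add: primal_solutions_def)
  show "Y \<in> primal_solutions C A b" if "Y \<in> psd_face Z" "constr_map A Y = b" for Y
    using that dual_slack_identity[OF A C dual, of Y b]
    by (simp add: primal_solutions_def psd_face_def val)
qed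

text \<open>
  Both inequalities come from the error bound for the optimal face, applied with two positive
  semidefinite substitutes for \<open>X\<close>: the shift by the least multiple of the identity, and the
  nearest point of the cone. The first substitute has slack larger by \<open>psd_shift X * trace Z\<close>;
  the penalty pays for this and has \<open>\<rho> - trace Z\<close> per unit left to pay for the
  displacement itself. The nearest point increases the slack by at most \<open>norm Z\<close> times the
  distance to the cone. Writing the slack as an objective gap costs \<open>norm y\<close> in the factor of
  the residual. The bound \<open>psd_shift X \<le> norm X\<close> keeps both substitutes in a fixed ball.
\<close>

lemma sdp_quadratic_growth:
  fixes C :: "real^'n^'n" and A :: "'m::finite \<Rightarrow> real^'n^'n"
  assumes C: "C \<in> sym_mats" and A: "\<And>i. A i \<in> sym_mats"
    and sd: "strong_duality C A b" and dsc: "dual_strict_complementary C A b Xbar y Z"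
    and \<rho>: "\<rho> > trace Z" and R: "R > 0"
  obtains \<kappa> where "\<kappa> > 0"
    "\<And>X. X \<in> sym_mats \<Longrightarrow> norm X \<le> R \<Longrightarrow>
      \<kappa> * (infdist X (primal_solutions C A b))\<^sup>2 \<le>
        trace_inner C X + \<rho> * psd_shift X - b \<bullet> y + (1 + norm y) * norm (constr_map A X - b)"
    "\<And>X. X \<in> sym_mats \<Longrightarrow> norm X \<le> R \<Longrightarrow>
      \<kappa> * (infdist X (primal_solutions C A b))\<^sup>2 \<le>
        trace_inner C X - b \<bullet> y + (1 + norm y) * norm (constr_map A X - b)
          + (1 + norm Z) * infdist X psd_cone"
proof -
  note opt = strict_complementary_optimum[OF C A sd dsc]
  define N where "N = norm (mat 1 :: real^'n^'n)"
  have N: "N \<ge> 0" by (simp add: N_def)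
  define \<Omega> where "\<Omega> = primal_solutions C A b"
  have "R * (2 + N) > 0" using R N by (intro mult_pos_pos) auto
  then obtain K where K: "K > 0" and bound: "\<And>X X'. norm X \<le> R * (2 + N) \<Longrightarrow> X' \<in> psd_cone \<Longrightarrow>
      norm X' \<le> R * (2 + N) \<Longrightarrow> \<exists>Y\<in>psd_face Z. constr_map A Y = constr_map A Xbar \<and>
        (norm (X - Y))\<^sup>2 \<le> K * (norm (constr_map A X - constr_map A Xbar) + norm (X - X') + Z \<bullet> X')"
    using psd_face_error_bound[OF linear_constr_map[of A, OF A] opt(2) opt(5)] by blast
  have dist: "(infdist X \<Omega>)\<^sup>2 \<le> K * (norm (constr_map A X - b) + norm (X - X') + Z \<bullet> X')"
    if "norm X \<le> R" "X' \<in> psd_cone" "norm X' \<le> R * (2 + N)" for X X'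
  proof -
    have "norm X \<le> R * (2 + N)"
      using that(1) R mult_nonneg_nonneg[OF less_imp_le[OF R] N] unfolding distrib_left by linarith
    from bound[OF this that(2,3)] obtain Y where Y: "Y \<in> psd_face Z" "constr_map A Y = b"
        "(norm (X - Y))\<^sup>2 \<le> K * (norm (constr_map A X - b) + norm (X - X') + Z \<bullet> X')"
      unfolding opt(6) by blast
    have "infdist X \<Omega> \<le> norm (X - Y)"
      using infdist_le[OF opt(7)[OF Y(1,2)], of X] by (simp add: \<Omega>_def dist_norm)
    then have "(infdist X \<Omega>)\<^sup>2 \<le> (norm (X - Y))\<^sup>2"
      by (intro power_mono infdist_nonneg)
    with Y(3) show ?thesis by simp
  qed
  have slack: "Z \<bullet> X \<le> trace_inner C X - b \<bullet> y + norm y * norm (constr_map A X - b)" for X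
    using dual_slack_identity[OF A C opt(3), of X b] Cauchy_Schwarz_ineq2[of y "constr_map A X - b"]
    by simp
  define \<epsilon> where "\<epsilon> = \<rho> - trace Z"
  have \<epsilon>: "\<epsilon> > 0" using \<rho> by (simp add: \<epsilon>_def)
  \<comment> \<open>Large enough that the surplus \<open>\<epsilon>\<close> of the penalty outweighs the displacement
      \<open>N\<close> per unit of shift.\<close>
  define M where "M = K * (1 + N / \<epsilon>)"
  have "K \<le> M" "K * N \<le> M * \<epsilon>"
    unfolding M_def using K \<epsilon> N by (simp_all add: field_simps)
  with K have M: "M > 0" "K \<le> M" "K * N \<le> M * \<epsilon>" by simp_all
  show ?thesis
  proof (rule that[of "1 / M"])
    show "1 / M > 0" using M by simp
    fix X :: "real^'n^'n"
    assume X: "X \<in> sym_mats" "norm X \<le> R"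
    define s where "s = norm (constr_map A X - b)"
    define D where "D = (infdist X (primal_solutions C A b))\<^sup>2"
    have s: "s \<ge> 0" by (simp add: s_def)
    show "1 / M * (infdist X (primal_solutions C A b))\<^sup>2 \<le>
        trace_inner C X + \<rho> * psd_shift X - b \<bullet> y + (1 + norm y) * norm (constr_map A X - b)"
    proof -
      define t where "t = psd_shift X"
      define X' where "X' = X + t *\<^sub>R mat 1"
      have t: "0 \<le> t" "t \<le> R"
        using psd_shift_nonneg psd_shift_le_norm[OF X(1)] X(2) by (auto simp: t_def)
      have X': "X' \<in> psd_cone" unfolding X'_def t_def by (rule psd_shift_psd[OF X(1)])
      have "norm X' \<le> norm X + t * N"
        using norm_triangle_ineq[of X "t *\<^sub>R mat 1"] t by (simp add: X'_def N_def)
      also have "\<dots> \<le> R * (2 + N)"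
        using X(2) mult_right_mono[OF t(2) N] R by (simp add: algebra_simps)
      finally have "D \<le> K * (s + norm (X - X') + Z \<bullet> X')"
        using dist[OF X(2) X'] by (simp add: D_def \<Omega>_def s_def)
      also have "norm (X - X') = t * N"
        using t by (simp add: X'_def N_def)
      also have "K * (s + t * N + Z \<bullet> X') = K * s + (K * N) * t + K * (Z \<bullet> X')"
        by (simp add: algebra_simps)
      also have "\<dots> \<le> M * s + (M * \<epsilon>) * t + M * (Z \<bullet> X')"
        using M s t psd_inner_nonneg[OF opt(2) X'] by (intro add_mono mult_right_mono) auto
      also have "\<dots> = M * (s + (Z \<bullet> X + \<rho> * t))"
        by (simp add: X'_def inner_add_right \<epsilon>_def trace_eq_inner_mat[of Z] algebra_simps)
      also have "\<dots> \<le> M * (s + (trace_inner C X - b \<bullet> y + norm y * s + \<rho> * t))"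
        using M slack[of X] by (intro mult_left_mono) (auto simp: s_def)
      finally have "1 / M * D \<le> s + (trace_inner C X - b \<bullet> y + norm y * s + \<rho> * t)"
        using M by (simp add: field_simps)
      then show ?thesis by (simp add: D_def t_def s_def algebra_simps)
    qed
    show "1 / M * (infdist X (primal_solutions C A b))\<^sup>2 \<le>
        trace_inner C X - b \<bullet> y + (1 + norm y) * norm (constr_map A X - b)
          + (1 + norm Z) * infdist X psd_cone"
    proof -
      obtain X' where X': "X' \<in> psd_cone" "infdist X psd_cone = dist X X'"
        using infdist_attains_inf[OF closed_psd_cone, of X] psd_zero by blast
      define d where "d = norm (X - X')"
      have "d \<le> norm X"
        using infdist_le[OF psd_zero, of X] X' by (simp add: d_def dist_norm)
      then have "norm X' \<le> R * 2"
        using norm_triangle_ineq4[of X "X - X'"] X(2) by (simp add: d_def)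
      also have "\<dots> \<le> R * (2 + N)" using R N by (intro mult_left_mono) auto
      finally have "D \<le> K * (s + d + Z \<bullet> X')"
        using dist[OF X(2) X'(1)] by (simp add: D_def \<Omega>_def s_def d_def)
      also have "\<dots> \<le> M * (s + d + Z \<bullet> X')"
        using M s psd_inner_nonneg[OF opt(2) X'(1)] by (intro mult_right_mono) (auto simp: d_def)
      also have "\<dots> \<le> M * (s + d + ((trace_inner C X - b \<bullet> y + norm y * s) + norm Z * d))"
      proof -
        have "Z \<bullet> X' = Z \<bullet> X + Z \<bullet> (X' - X)" by (simp add: inner_diff_right)
        also have "Z \<bullet> (X' - X) \<le> norm Z * d"
          using norm_cauchy_schwarz[of Z "X' - X"] by (simp add: d_def norm_minus_commute)
        finally show ?thesis
          using M slack[of X] by (intro mult_left_mono) (auto simp: s_def)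
      qed
      finally have "1 / M * D \<le> s + d + ((trace_inner C X - b \<bullet> y + norm y * s) + norm Z * d)"
        using M by (simp add: field_simps)
      then show ?thesis
        using X'(2) by (simp add: D_def s_def d_def dist_norm algebra_simps)
    qed
  qed
qed

text \<open>
  Quadratic growth on a sphere around \<open>Xbar\<close> that stays away from a bounded solution set gives
  a positive gap there. Along a segment from \<open>Xbar\<close> through that sphere the penalised
  objective is convex, so beyond the sphere it grows at least linearly.
\<close>

lemma penalised_sublevel_bounded:
  fixes C :: "real^'n^'n" and A :: "'m::finite \<Rightarrow> real^'n^'n"
  assumes C: "C \<in> sym_mats" and A: "\<And>i. A i \<in> sym_mats"
    and sd: "strong_duality C A b" and dsc: "dual_strict_complementary C A b Xbar y Z"
    and \<rho>: "\<rho> > trace Z" and bdd: "bounded (primal_solutions C A b)"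
  shows "bounded {X \<in> sym_mats. trace_inner C X + \<rho> * psd_shift X \<le> \<beta> \<and> constr_map A X = b}"
proof -
  note opt = strict_complementary_optimum[OF C A sd dsc]
  define \<Omega> where "\<Omega> = primal_solutions C A b"
  have Xbar: "Xbar \<in> psd_cone" "Xbar \<in> \<Omega>" "trace_inner C Xbar = b \<bullet> y"
    using opt(1,4) by (auto simp: primal_solutions_def \<Omega>_def)
  have \<rho>0: "\<rho> \<ge> 0" using \<rho> psd_trace_nonneg[OF opt(2)] by simp
  obtain r0 where r0: "\<And>Y. Y \<in> \<Omega> \<Longrightarrow> dist Xbar Y \<le> r0"
    using bdd bounded_any_center[of \<Omega> Xbar] by (auto simp: \<Omega>_def)
  \<comment> \<open>The sphere of radius \<open>r\<close> has distance at least \<open>1\<close> from the solutions.\<close>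
  define r where "r = r0 + 1"
  have r: "r > 0" using r0[OF Xbar(2)] by (simp add: r_def)
  have "norm Xbar + r > 0" using r by (simp add: add_nonneg_pos)
  then obtain \<kappa> where \<kappa>: "\<kappa> > 0" and growth: "\<And>X. X \<in> sym_mats \<Longrightarrow> norm X \<le> norm Xbar + r \<Longrightarrow>
      \<kappa> * (infdist X \<Omega>)\<^sup>2 \<le>
        trace_inner C X + \<rho> * psd_shift X - b \<bullet> y + (1 + norm y) * norm (constr_map A X - b)"
    using sdp_quadratic_growth[OF C A sd dsc \<rho>] unfolding \<Omega>_def by metis
  have "dist Xbar X \<le> max r (r * (\<beta> - b \<bullet> y) / \<kappa>)"
    if X: "X \<in> sym_mats" "trace_inner C X + \<rho> * psd_shift X \<le> \<beta>" "constr_map A X = b" for X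
  proof (cases "dist Xbar X \<le> r")
    case False
    define n where "n = norm (X - Xbar)"
    have n: "n > r" using False by (simp add: n_def dist_norm norm_minus_commute)
    define l where "l = r / n"
    have l: "0 < l" "l < 1" "l * n = r" using n r by (auto simp: l_def)
    define V where "V = l *\<^sub>R X + (1 - l) *\<^sub>R Xbar"
    have "V - Xbar = l *\<^sub>R (X - Xbar)" by (simp add: V_def algebra_simps)
    then have VX: "norm (V - Xbar) = r" using l by (simp flip: n_def)
    have V: "V \<in> sym_mats"
      unfolding V_def using X(1) psd_sym[OF Xbar(1)]
      by (intro subspace_add subspace_scale subspace_sym_mats)
    have AV: "constr_map A V = b"
      using linear_constr_map[of A] A X(3) opt(6)
      by (simp add: V_def linear_add linear_scale scaleR_left_distrib[symmetric])
    have "norm V \<le> norm Xbar + r"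
      using norm_triangle_ineq[of Xbar "V - Xbar"] VX by simp
    from growth[OF V this] have "\<kappa> * (infdist V \<Omega>)\<^sup>2 \<le> trace_inner C V + \<rho> * psd_shift V - b \<bullet> y"
      by (simp add: AV)
    moreover have "1 \<le> (infdist V \<Omega>)\<^sup>2"
    proof -
      have "1 \<le> dist V Y" if "Y \<in> \<Omega>" for Y
        using r0[OF that] VX dist_triangle[of V Xbar Y] dist_triangle[of Xbar V Y]
          dist_triangle2[of V Xbar Y]
        by (simp add: r_def dist_norm norm_minus_commute)
      then have "1 \<le> infdist V \<Omega>"
        using Xbar(2) by (auto simp: infdist_def intro!: cINF_greatest)
      then show ?thesis by (simp add: one_le_power)
    qed
    then have "\<kappa> \<le> \<kappa> * (infdist V \<Omega>)\<^sup>2" using \<kappa> by simp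
    moreover have "psd_shift V \<le> l * psd_shift X"
    proof (rule psd_shift_le[OF V])
      have "V + (l * psd_shift X) *\<^sub>R mat 1 = l *\<^sub>R (X + psd_shift X *\<^sub>R mat 1) + (1 - l) *\<^sub>R Xbar"
        by (simp add: V_def scaleR_add_right)
      also have "\<dots> \<in> psd_cone"
        using l by (intro psd_add psd_scaleR psd_shift_psd X(1) Xbar(1)) auto
      finally show "V + (l * psd_shift X) *\<^sub>R mat 1 \<in> psd_cone" .
      show "0 \<le> l * psd_shift X"
        using l by (simp add: psd_shift_nonneg)
    qed
    then have "\<rho> * psd_shift V \<le> l * (\<rho> * psd_shift X)"
      using \<rho>0 by (metis mult.left_commute mult_left_mono)
    moreover have "trace_inner C V = l * trace_inner C X + (1 - l) * (b \<bullet> y)"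
      using Xbar(3) by (simp add: V_def trace_inner_eq_inner[OF C] inner_add_right)
    ultimately have "\<kappa> \<le> l * (trace_inner C X + \<rho> * psd_shift X) - l * (b \<bullet> y)"
      by (simp add: algebra_simps)
    also have "\<dots> \<le> l * \<beta> - l * (b \<bullet> y)"
      using l X(2) by simp
    finally have "\<kappa> * n \<le> (l * \<beta> - l * (b \<bullet> y)) * n"
      using n r by (intro mult_right_mono) auto
    also have "\<dots> = (l * n) * (\<beta> - b \<bullet> y)"
      by (simp add: algebra_simps)
    finally have "\<kappa> * n \<le> (l * n) * (\<beta> - b \<bullet> y)" .
    then have "n \<le> r * (\<beta> - b \<bullet> y) / \<kappa>"
      using \<kappa> l(3) by (simp add: field_simps)
    then show ?thesis by (simp add: n_def dist_norm norm_minus_commute)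
  qed simp
  then show ?thesis
    unfolding bounded_def by blast
qed

lemma exact_penalty_eq: "exact_penalty \<rho> X = ereal (\<rho> * psd_shift X)"
  by (simp add: exact_penalty_def psd_shift_def)

text \<open>
  Since the indicator function dominates every penalty function, both inequalities and the
  boundedness of sublevel sets only have to be proved for the penalty.
\<close>

lemma exact_penalty_le_indicator: "exact_penalty \<rho> X \<le> set_indicator psd_cone X"
  by (simp add: exact_penalty_eq set_indicator_def psd_shift_psd_eq_0)

section \<open>Quadratic growth of the penalised semidefinite program\<close>

theorem theorem1:
  fixes C :: "real^'n^'n" and A :: "'m::finite \<Rightarrow> real^'n^'n" and b :: "real^'m"
    and Xbar Zbar :: "real^'n^'n" and ybar :: "real^'m"
    and g :: "real^'n^'n \<Rightarrow> ereal"
  assumes C_sym: "C \<in> sym_mats"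
    and A_sym: "\<And>i. A i \<in> sym_mats"
    and A_surj: "constr_map A ` sym_mats = UNIV"
    and sd: "strong_duality C A b"
    and dsc: "dual_strict_complementary C A b Xbar ybar Zbar"
    and g: "g = set_indicator psd_cone \<or> (\<exists>\<rho>. \<rho> > trace Zbar \<and> g = exact_penalty \<rho>)"
  shows
    "(\<forall>U. compact U \<and> U \<subseteq> sym_mats \<and> U \<inter> primal_solutions C A b \<noteq> {} \<longrightarrow>
       (\<exists>\<kappa> \<gamma> \<alpha> :: real. \<kappa> > 0 \<and> \<gamma> > 0 \<and> \<alpha> > 0 \<and>
          (\<forall>X\<in>U. penalised_objective C g X - primal_value C A b
                    + ereal (\<gamma> * norm (constr_map A X - b))
                  \<ge> ereal (\<kappa> * (infdist X (primal_solutions C A b))\<^sup>2)) \<and>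
          (\<forall>X\<in>U. ereal (trace_inner C X) - primal_value C A b
                    + ereal (\<gamma> * norm (constr_map A X - b))
                    + ereal (\<alpha> * infdist X psd_cone)
                  \<ge> ereal (\<kappa> * (infdist X (primal_solutions C A b))\<^sup>2)))) \<and>
     (compact (primal_solutions C A b) \<longrightarrow>
       (\<forall>\<beta>::real. \<forall>U. U = {X \<in> sym_mats. penalised_objective C g X \<le> ereal \<beta> \<and> constr_map A X = b} \<longrightarrow>
       (\<exists>\<kappa> \<gamma> \<alpha> :: real. \<kappa> > 0 \<and> \<gamma> > 0 \<and> \<alpha> > 0 \<and>
          (\<forall>X\<in>U. penalised_objective C g X - primal_value C A b
                    + ereal (\<gamma> * norm (constr_map A X - b))
                  \<ge> ereal (\<kappa> * (infdist X (primal_solutions C A b))\<^sup>2)) \<and>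
          (\<forall>X\<in>U. ereal (trace_inner C X) - primal_value C A b
                    + ereal (\<gamma> * norm (constr_map A X - b))
                    + ereal (\<alpha> * infdist X psd_cone)
                  \<ge> ereal (\<kappa> * (infdist X (primal_solutions C A b))\<^sup>2)))))"
    (is "(\<forall>U. ?cond U \<longrightarrow> ?growth U) \<and> (_ \<longrightarrow> (\<forall>\<beta> U. U = ?sub \<beta> \<longrightarrow> ?growth U))")
proof -
  note val = strict_complementary_optimum(1)[OF C_sym A_sym sd dsc]
  obtain \<rho> where \<rho>: "\<rho> > trace Zbar" and g_ge: "\<And>X. exact_penalty \<rho> X \<le> g X"
  proof (cases "g = set_indicator psd_cone")
    case True
    then show ?thesis
      using exact_penalty_le_indicator by (intro that[of "trace Zbar + 1"]) auto
  next
    case False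
    then show ?thesis using g that by blast
  qed
  have obj_ge: "ereal (trace_inner C X + \<rho> * psd_shift X) \<le> penalised_objective C g X" for X
    using g_ge[of X] unfolding penalised_objective_def exact_penalty_eq
    by (cases "g X") auto
  have growth: "?growth U" if U: "bounded U" "U \<subseteq> sym_mats" for U
  proof -
    obtain R where R: "R > 0" "\<And>X. X \<in> U \<Longrightarrow> norm X \<le> R"
      using U(1) by (auto simp: bounded_pos)
    from sdp_quadratic_growth[OF C_sym A_sym sd dsc \<rho> R(1)]
    obtain \<kappa> where \<kappa>: "\<kappa> > 0"
      and 1: "\<And>X. X \<in> sym_mats \<Longrightarrow> norm X \<le> R \<Longrightarrow>
        \<kappa> * (infdist X (primal_solutions C A b))\<^sup>2 \<le> trace_inner C X + \<rho> * psd_shift X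
          - b \<bullet> ybar + (1 + norm ybar) * norm (constr_map A X - b)"
      and 2: "\<And>X. X \<in> sym_mats \<Longrightarrow> norm X \<le> R \<Longrightarrow>
        \<kappa> * (infdist X (primal_solutions C A b))\<^sup>2 \<le> trace_inner C X - b \<bullet> ybar
          + (1 + norm ybar) * norm (constr_map A X - b) + (1 + norm Zbar) * infdist X psd_cone"
      by blast
    show ?thesis
    proof (intro exI conjI ballI)
      show "\<kappa> > 0" "1 + norm ybar > 0" "1 + norm Zbar > 0"
        using \<kappa> by (auto simp: add_pos_nonneg)
      fix X assume "X \<in> U"
      then have X: "X \<in> sym_mats" "norm X \<le> R" using U R by auto
      have "ereal (\<kappa> * (infdist X (primal_solutions C A b))\<^sup>2) \<le>
          ereal (trace_inner C X + \<rho> * psd_shift X) - ereal (b \<bullet> ybar)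
            + ereal ((1 + norm ybar) * norm (constr_map A X - b))"
        using 1[OF X] by simp
      also have "\<dots> \<le> penalised_objective C g X - primal_value C A b
            + ereal ((1 + norm ybar) * norm (constr_map A X - b))"
        unfolding val by (intro add_right_mono ereal_minus_mono obj_ge order_refl)
      finally show "ereal (\<kappa> * (infdist X (primal_solutions C A b))\<^sup>2) \<le>
          penalised_objective C g X - primal_value C A b
            + ereal ((1 + norm ybar) * norm (constr_map A X - b))" .
      show "ereal (\<kappa> * (infdist X (primal_solutions C A b))\<^sup>2) \<le>
          ereal (trace_inner C X) - primal_value C A b
            + ereal ((1 + norm ybar) * norm (constr_map A X - b))
            + ereal ((1 + norm Zbar) * infdist X psd_cone)"
        using 2[OF X] unfolding val by simp
    qed
  qed
  show ?thesis
  proof (intro conjI allI impI)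
    fix U assume "?cond U"
    then show "?growth U" using growth compact_imp_bounded by blast
  next
    fix \<beta> :: real and U
    assume cpt: "compact (primal_solutions C A b)" and U: "U = ?sub \<beta>"
    have "U \<subseteq> {X \<in> sym_mats. trace_inner C X + \<rho> * psd_shift X \<le> \<beta> \<and> constr_map A X = b}"
      unfolding U using order_trans[OF obj_ge] by fastforce
    then have "bounded U"
      using penalised_sublevel_bounded[OF C_sym A_sym sd dsc \<rho> compact_imp_bounded[OF cpt]]
      by (rule bounded_subset[rotated])
    then show "?growth U" using U by (intro growth) auto
  qed
qed

end
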